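(* Let $k$ be a positive integer with $k \equiv 7 \pmod{15}$ and let \[ n = L_{CC}(10,k) = \frac{512k^5+1280k^4+6080k^3+7840k^2+10010k+3741}{3125}. \] Then there is an undirected Cayley graph of the cyclic group $\mathbb{Z}_n$ on five generators which has diameter $k$. Moreover, a generating set for such a graph is \[ \Big\{1,\ \tfrac{128k^4+256k^3+1192k^2+1064k+883}{625},\ \tfrac{512k^5+640k^4+3200k^3-2520k^2-8510k-12624}{9375},\ \tfrac{512k^5+640k^4+5600k^3+1080k^2+4540k-6699}{9375},\ \tfrac{512k^5+640k^4+5600k^3+1080k^2+12040k-2949}{9375}\Big\}, \] i.e. the Cayley graph of $\mathbb{Z}_n$ with connection set $\{\pm g_1,\dots,\pm g_5\}$, where $g_1,\dots,g_5$ are these integers taken modulo $n$, has diameter $k$.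
   Context: For a positive integer $n$ and integers $g_1,\dots,g_5$, the undirected Cayley (circulant) graph of the cyclic group $\mathbb{Z}_n$ with generating set $\{g_1,\dots,g_5\}$ has vertex set $\mathbb{Z}_n$, with $i$ and $j$ adjacent if and only if $j-i \equiv \pm g_t \pmod n$ for some $t$. Its diameter is the maximum over pairs of vertices of the graph distance. The notation $L_{CC}(10,k)$ is just a name for the displayed polynomial value. *)

theory Defs
  imports "Graph_Theory.Graph_Theory" "HOL-Number_Theory.Cong"
begin

text \<open>The vertices \<open>{0..<n}\<close> are the canonical representatives of \<open>\<int>\<^sub>n\<close>. An undirected graph is
  encoded, as usual in this library, as a symmetric digraph. The elements of \<open>S\<close> are arbitrary
  integers and matter only modulo \<open>n\<close>.\<close>

definition circulant_graph :: "int \<Rightarrow> int set \<Rightarrow> (int, int \<times> int) pre_digraph" where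
  "circulant_graph n S =
    \<lparr> verts = {0..<n},
      arcs = {(i, j). i \<in> {0..<n} \<and> j \<in> {0..<n} \<and>
                (\<exists>g\<in>S. [j - i = g] (mod n) \<or> [j - i = - g] (mod n))},
      tail = fst, head = snd \<rparr>"

lemma pseudo_graph_circulant_graph: "pseudo_graph (circulant_graph n S)"
proof
  show "finite (arcs (circulant_graph n S))"
    by (rule finite_subset[of _ "{0..<n} \<times> {0..<n}"]) (auto simp: circulant_graph_def)
  have "[i - j = - g] (mod n)" if "[j - i = g] (mod n)" for i j g :: int
    using cong_minus_minus_iff[of "j - i" g n] that by simp
  moreover have "[i - j = g] (mod n)" if "[j - i = - g] (mod n)" for i j g :: int
    using cong_minus_minus_iff[of "j - i" "- g" n] that by simp
  ultimately show "symmetric (circulant_graph n S)"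
    by (fastforce simp: symmetric_conv circulant_graph_def)
qed (auto simp: circulant_graph_def)

text \<open>The distance is the minimal cost of a walk when every arc costs 1; it is \<open>\<infinity>\<close> when there is no
  walk, so a finite diameter includes connectedness. For a finite nonempty vertex set the
  supremum is a maximum.\<close>

definition graph_dist :: "('a, 'b) pre_digraph \<Rightarrow> 'a \<Rightarrow> 'a \<Rightarrow> ereal" where
  "graph_dist G u v = wf_digraph.\<mu> G (\<lambda>_. 1) u v"

definition diameter :: "('a, 'b) pre_digraph \<Rightarrow> ereal" where
  "diameter G = (SUP (u, v) \<in> verts G \<times> verts G. graph_dist G u v)"

text \<open>The order and the generators are given by rational expressions; that they take integer values
  at the relevant \<open>k\<close> is part of what is claimed, hence the type \<open>rat\<close>.\<close>

definition L_CC_10 :: "rat \<Rightarrow> rat" where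
  "L_CC_10 k = (512*k^5 + 1280*k^4 + 6080*k^3 + 7840*k^2 + 10010*k + 3741) / 3125"

definition gen2 :: "rat \<Rightarrow> rat" where
  "gen2 k = (128*k^4 + 256*k^3 + 1192*k^2 + 1064*k + 883) / 625"

definition gen3 :: "rat \<Rightarrow> rat" where
  "gen3 k = (512*k^5 + 640*k^4 + 3200*k^3 - 2520*k^2 - 8510*k - 12624) / 9375"

definition gen4 :: "rat \<Rightarrow> rat" where
  "gen4 k = (512*k^5 + 640*k^4 + 5600*k^3 + 1080*k^2 + 4540*k - 6699) / 9375"

definition gen5 :: "rat \<Rightarrow> rat" where
  "gen5 k = (512*k^5 + 640*k^4 + 5600*k^3 + 1080*k^2 + 12040*k - 2949) / 9375"

end

theory Submission
  imports Defs
begin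

text \<open>
  Write \<open>k = 15 m + 7\<close> and \<open>h = 6 m + 3\<close>, so \<open>2 k + 1 = 5 h\<close>. The vectors \<open>x \<in> \<int>\<^sup>5\<close> with
  \<open>x\<^sub>1 g\<^sub>1 + \<dots> + x\<^sub>5 g\<^sub>5 \<equiv> 0 (mod n)\<close> form a lattice \<open>L\<close>, and the diameter is the covering radius of \<open>L\<close>
  in the \<open>\<ell>\<^sub>1\<close> norm. The lattice is a slightly twisted body-centred cubic lattice: if \<open>E = 2 h I + A\<close> with
  the antisymmetric matrix
  \<open>A = [[0,0,0,1,-1], [0,0,-1,1,0], [0,1,0,1,0], [-1,-1,-1,0,-1], [1,0,0,1,0]]\<close>, the rows of \<open>E\<close>
  together with half their sum generate \<open>L\<close>. The graph of nonzero entries of \<open>A\<close> is a bowtie, the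
  triangles \<open>{1,4,5}\<close> and \<open>{2,3,4}\<close>; its degrees are even, so \<open>\<sigma> E / 2 \<in> L\<close> for every sign vector \<open>\<sigma>\<close>.

  \<^emph>\<open>Upper bound.\<close> By antisymmetry \<open>\<sigma> E / 2\<close> has norm exactly \<open>5 h = 2 k + 1\<close>, so a point \<open>x\<close> of the box
  spanned by \<open>0\<close> and \<open>\<sigma> E / 2\<close> is within \<open>k\<close> of one of these two corners. Every coset of the row lattice
  of \<open>E\<close> meets one of the boxes: if \<open>x\<close> leaves the box of its orthant in direction \<open>i\<close>, then subtracting
  \<open>\<plusminus>e\<^sub>i\<close> decreases the norm. This fails only for points with coordinates near \<open>0\<close>, which is repaired by
  minimising a norm that penalises zero coordinates.

  \<^emph>\<open>Lower bound.\<close> With \<open>h = 2 t + 1\<close>, the point \<open>(t + 1, t + 1, t, t, t)\<close> has norm \<open>k\<close> and no lattice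
  vector is closer to it than \<open>0\<close>.
\<close>

section \<open>Upper bound on the covering radius\<close>

text \<open>
  The weights \<open>c = 1\<close> for the four outer coordinates and \<open>c = 2\<close> for the centre of the bowtie are
  chosen such that the slopes near \<open>0\<close> differ from \<open>\<plusminus>3\<close> by so little that the integrality of the
  box bounds absorbs the error.
\<close>

definition bump :: "int \<Rightarrow> int \<Rightarrow> int" where
  "bump c x = (if x = 0 then c else 3 * \<bar>x\<bar>)"

definition slope :: "int \<Rightarrow> int \<Rightarrow> int" where
  "slope c x = bump c (x + 1) - bump c x"

lemma slope_eq:
  "0 < c \<Longrightarrow> slope c x =
    (if x \<ge> 1 then 3 else if x = 0 then 3 - c else if x = -1 then c - 3 else -3)"
  by (auto simp: slope_def bump_def)

text \<open>
  A zero coordinate of the triangle may take either sign; it is chosen in favour of the centre \<open>w\<close> of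
  the bowtie if \<open>w \<ge> 2\<close>, and in favour of the other vertex otherwise.
\<close>
lemma triangle_signs:
  fixes h w y z :: int
  assumes "h \<ge> 3" "w \<ge> 0"
    and "6 * y \<le> 6 * h + slope 2 (- w) + slope 1 z"
    and "- 6 * y \<le> 6 * h + slope 2 w + slope 1 (- z)"
    and "6 * z \<le> 6 * h + slope 1 (- y) + slope 2 (- w)"
    and "- 6 * z \<le> 6 * h + slope 1 y + slope 2 w"
  shows "\<exists>s\<in>{1, -1}. \<exists>t\<in>{1, -1}. 0 \<le> s * y \<and> 0 \<le> t * z
    \<and> 2 * (s * y) \<le> 2 * h + s * (t - 1) \<and> 2 * (t * z) \<le> 2 * h + t * (- s - 1)
    \<and> (w \<ge> 2 \<longrightarrow> slope 1 y \<le> 3 * s + 1 \<and> slope 1 z \<le> 3 * t + 1)"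
  using assms by (simp add: slope_eq split: if_splits; arith)

text \<open>For \<open>0 < x < 2 * h\<close> the hypothesis reads
  \<open>3 * x <= 3 * (2 * h - x) + d\<close>. The bound 12, for four neighbours of slope at most 3,
  keeps \<open>d\<close> below \<open>6 * h - c\<close>, which excludes
  \<open>x >= 2 * h\<close>.\<close>

lemma bump_bound:
  assumes "h \<ge> 3" "0 < c" "c < 3" "d \<le> 12" "bump c x \<le> bump c (x - 2 * h) + d"
  shows "6 * x \<le> 6 * h + d"
  using assms by (auto simp: bump_def abs_if split: if_splits)

lemma bump_minus: "bump c (- x) = bump c x"
  by (simp add: bump_def)

lemma bump_step_down: "bump c (x - 1) = bump c x + slope c (- x)"
  using bump_minus[of c "x - 1"] bump_minus[of c x] by (simp add: slope_def)

lemma bump_step_up: "bump c (x + 1) = bump c x + slope c x"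
  by (simp add: slope_def)

text \<open>The union over all sign vectors \<open>\<sigma>\<close> of the boxes spanned by \<open>0\<close> and \<open>\<sigma> E / 2\<close>.\<close>
definition in_sign_box :: "int \<Rightarrow> int \<Rightarrow> int \<Rightarrow> int \<Rightarrow> int \<Rightarrow> int \<Rightarrow> bool" where
  "in_sign_box h x1 x2 x3 x4 x5 \<longleftrightarrow>
    (\<exists>s1\<in>{1, -1}. \<exists>s2\<in>{1, -1}. \<exists>s3\<in>{1, -1}. \<exists>s4\<in>{1, -1}. \<exists>s5\<in>{1, -1}.
      0 \<le> s1 * x1 \<and> 2 * (s1 * x1) \<le> 2 * h + s1 * (s5 - s4) \<and>
      0 \<le> s2 * x2 \<and> 2 * (s2 * x2) \<le> 2 * h + s2 * (s3 - s4) \<and>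
      0 \<le> s3 * x3 \<and> 2 * (s3 * x3) \<le> 2 * h + s3 * (- s2 - s4) \<and>
      0 \<le> s4 * x4 \<and> 2 * (s4 * x4) \<le> 2 * h + s4 * (s1 + s2 + s3 + s5) \<and>
      0 \<le> s5 * x5 \<and> 2 * (s5 * x5) \<le> 2 * h + s5 * (- s1 - s4))"

text \<open>Central symmetry, used to reduce to \<open>x4 >= 0\<close>: all signs flip, and they
  bound each other only through products of two.\<close>

lemma in_sign_box_minusD:
  assumes "in_sign_box h (- x1) (- x2) (- x3) (- x4) (- x5)"
  shows "in_sign_box h x1 x2 x3 x4 x5"
proof -
  obtain s1 s2 s3 s4 s5 :: int
    where s: "s1 \<in> {1, -1}" "s2 \<in> {1, -1}" "s3 \<in> {1, -1}" "s4 \<in> {1, -1}" "s5 \<in> {1, -1}"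
      and b: "0 \<le> s1 * - x1 \<and> 2 * (s1 * - x1) \<le> 2 * h + s1 * (s5 - s4) \<and>
        0 \<le> s2 * - x2 \<and> 2 * (s2 * - x2) \<le> 2 * h + s2 * (s3 - s4) \<and>
        0 \<le> s3 * - x3 \<and> 2 * (s3 * - x3) \<le> 2 * h + s3 * (- s2 - s4) \<and>
        0 \<le> s4 * - x4 \<and> 2 * (s4 * - x4) \<le> 2 * h + s4 * (s1 + s2 + s3 + s5) \<and>
        0 \<le> s5 * - x5 \<and> 2 * (s5 * - x5) \<le> 2 * h + s5 * (- s1 - s4)"
    using assms unfolding in_sign_box_def by blast
  have neg: "- s \<in> {1, -1}" if "s \<in> {1, -1}" for s :: int
    using that by auto
  show ?thesis
    unfolding in_sign_box_def
    by (rule bexI[OF _ neg[OF s(1)]], rule bexI[OF _ neg[OF s(2)]], rule bexI[OF _ neg[OF s(3)]],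
        rule bexI[OF _ neg[OF s(4)]], rule bexI[OF _ neg[OF s(5)]])
      (use b in \<open>simp add: algebra_simps\<close>)
qed

text \<open>With \<open>s4 = 1\<close> the two triangles share no other vertex, so their signs are
  chosen independently; only the bound on \<open>x4\<close> couples them.\<close>

lemma in_sign_box_nonneg:
  fixes h x1 x2 x3 x4 x5 :: int
  assumes h: "h \<ge> 3" and "x4 \<ge> 0"
    and 1: "6 * x1 \<le> 6 * h + slope 2 (- x4) + slope 1 x5" "- 6 * x1 \<le> 6 * h + slope 2 x4 + slope 1 (- x5)"
    and 2: "6 * x2 \<le> 6 * h + slope 2 (- x4) + slope 1 x3" "- 6 * x2 \<le> 6 * h + slope 2 x4 + slope 1 (- x3)"
    and 3: "6 * x3 \<le> 6 * h + slope 1 (- x2) + slope 2 (- x4)" "- 6 * x3 \<le> 6 * h + slope 1 x2 + slope 2 x4"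
    and 5: "6 * x5 \<le> 6 * h + slope 1 (- x1) + slope 2 (- x4)" "- 6 * x5 \<le> 6 * h + slope 1 x1 + slope 2 x4"
    and 4: "6 * x4 \<le> 6 * h + slope 1 x1 + slope 1 x2 + slope 1 x3 + slope 1 x5"
  shows "in_sign_box h x1 x2 x3 x4 x5"
proof -
  obtain s1 s5 :: int where s15: "s1 \<in> {1, -1}" "s5 \<in> {1, -1}" "0 \<le> s1 * x1" "0 \<le> s5 * x5"
      "2 * (s1 * x1) \<le> 2 * h + s1 * (s5 - 1)" "2 * (s5 * x5) \<le> 2 * h + s5 * (- s1 - 1)"
      "x4 \<ge> 2 \<longrightarrow> slope 1 x1 \<le> 3 * s1 + 1 \<and> slope 1 x5 \<le> 3 * s5 + 1"
    using triangle_signs[OF h \<open>x4 \<ge> 0\<close> 1 5] by blast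
  obtain s2 s3 :: int where s23: "s2 \<in> {1, -1}" "s3 \<in> {1, -1}" "0 \<le> s2 * x2" "0 \<le> s3 * x3"
      "2 * (s2 * x2) \<le> 2 * h + s2 * (s3 - 1)" "2 * (s3 * x3) \<le> 2 * h + s3 * (- s2 - 1)"
      "x4 \<ge> 2 \<longrightarrow> slope 1 x2 \<le> 3 * s2 + 1 \<and> slope 1 x3 \<le> 3 * s3 + 1"
    using triangle_signs[OF h \<open>x4 \<ge> 0\<close> 2 3] by blast
  have "2 * x4 \<le> 2 * h + (s1 + s2 + s3 + s5)"
  proof (cases "x4 \<ge> 2")
    case True
    with s15(7) s23(7) have "slope 1 x1 \<le> 3 * s1 + 1" "slope 1 x2 \<le> 3 * s2 + 1"
      "slope 1 x3 \<le> 3 * s3 + 1" "slope 1 x5 \<le> 3 * s5 + 1"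
      by simp_all
    with 4 have "6 * x4 \<le> 6 * h + 3 * (s1 + s2 + s3 + s5) + 4"
      by (smt (verit))
    \<comment> \<open>So \<open>6 * x4 - 6 * h - 3 * (s1 + s2 + s3 + s5)\<close> is a multiple of 6,
      and being at most 4 it is at most 0.\<close>
    moreover have "even (s1 + s2 + s3 + s5)"
      using s15(1,2) s23(1,2) by auto
    ultimately show ?thesis
      by presburger
  next
    case False
    with h s15(1,2) s23(1,2) show ?thesis by auto
  qed
  with s15(3-6) s23(3-6) \<open>x4 \<ge> 0\<close> show ?thesis
    unfolding in_sign_box_def
    by (intro bexI[OF _ s15(1)] bexI[OF _ s23(1)] bexI[OF _ s23(2)] bexI[of _ 1] bexI[OF _ s15(2)]) simp_all
qed

text \<open>Comparing with translates by one row or its negative suffices: one coordinate moves by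
  \<open>2 * h\<close> and its neighbours by 1, which changes their \<open>bump\<close> by a
  slope.\<close>

lemma in_sign_box_of_bump_minimal:
  fixes h x1 x2 x3 x4 x5 :: int
  assumes h: "h \<ge> 3"
    and min: "\<And>d1 d2 d3 d4 d5. bump 1 x1 + bump 1 x2 + bump 1 x3 + bump 2 x4 + bump 1 x5 \<le>
      bump 1 (x1 - (2 * h * d1 - d4 + d5)) + bump 1 (x2 - (2 * h * d2 + d3 - d4)) +
      bump 1 (x3 - (2 * h * d3 - d2 - d4)) + bump 2 (x4 - (2 * h * d4 + d1 + d2 + d3 + d5)) +
      bump 1 (x5 - (2 * h * d5 - d1 - d4))"
  shows "in_sign_box h x1 x2 x3 x4 x5"
proof -
  have slope_le: "slope 1 x \<le> 3" "slope 2 x \<le> 3" for x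
    by (auto simp: slope_eq)
  have le12: "slope 2 x + slope 1 y \<le> 12" "slope 1 x + slope 2 y \<le> 12"
    "slope 1 x + slope 1 y + slope 1 z + slope 1 w \<le> 12" for x y z w
    using slope_le[of x] slope_le[of y] slope_le[of z] slope_le[of w] by linarith+
  note steps = bump_step_up bump_step_down
  have up: "6 * x \<le> 6 * h + d"
    if "bump c x \<le> bump c (x - 2 * h) + d" "d \<le> 12" "c = 1 \<or> c = 2" for c x d
    using bump_bound[OF h _ _ that(2,1)] that(3) by auto
  have down: "- 6 * x \<le> 6 * h + d"
    if "bump c x \<le> bump c (x + 2 * h) + d" "d \<le> 12" "c = 1 \<or> c = 2" for c x d
    using up[of c "- x" d] that bump_minus[of c x] bump_minus[of c "x + 2 * h"] by simp
  \<comment> \<open>The arguments of \<open>min\<close> are the coefficients of rows 1, 4, 5, 2, 3,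
    in order of first occurrence.\<close>
  have p1: "6 * x1 \<le> 6 * h + (slope 2 (- x4) + slope 1 x5)"
    by (rule up[of 1, OF _ le12(1)]) (use min[of 1 0 0 0 0] in \<open>simp_all add: steps\<close>)
  have n1: "- 6 * x1 \<le> 6 * h + (slope 2 x4 + slope 1 (- x5))"
    by (rule down[of 1, OF _ le12(1)]) (use min[of "-1" 0 0 0 0] in \<open>simp_all add: steps\<close>)
  have p2: "6 * x2 \<le> 6 * h + (slope 2 (- x4) + slope 1 x3)"
    by (rule up[of 1, OF _ le12(1)]) (use min[of 0 0 0 1 0] in \<open>simp_all add: steps\<close>)
  have n2: "- 6 * x2 \<le> 6 * h + (slope 2 x4 + slope 1 (- x3))"
    by (rule down[of 1, OF _ le12(1)]) (use min[of 0 0 0 "-1" 0] in \<open>simp_all add: steps\<close>)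
  have p3: "6 * x3 \<le> 6 * h + (slope 1 (- x2) + slope 2 (- x4))"
    by (rule up[of 1, OF _ le12(2)]) (use min[of 0 0 0 0 1] in \<open>simp_all add: steps\<close>)
  have n3: "- 6 * x3 \<le> 6 * h + (slope 1 x2 + slope 2 x4)"
    by (rule down[of 1, OF _ le12(2)]) (use min[of 0 0 0 0 "-1"] in \<open>simp_all add: steps\<close>)
  have p4: "6 * x4 \<le> 6 * h + (slope 1 x1 + slope 1 x2 + slope 1 x3 + slope 1 x5)"
    by (rule up[of 2, OF _ le12(3)]) (use min[of 0 1 0 0 0] in \<open>simp_all add: steps\<close>)
  have n4: "- 6 * x4 \<le> 6 * h + (slope 1 (- x1) + slope 1 (- x2) + slope 1 (- x3) + slope 1 (- x5))"
    by (rule down[of 2, OF _ le12(3)]) (use min[of 0 "-1" 0 0 0] in \<open>simp_all add: steps\<close>)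
  have p5: "6 * x5 \<le> 6 * h + (slope 1 (- x1) + slope 2 (- x4))"
    by (rule up[of 1, OF _ le12(2)]) (use min[of 0 0 1 0 0] in \<open>simp_all add: steps\<close>)
  have n5: "- 6 * x5 \<le> 6 * h + (slope 1 x1 + slope 2 x4)"
    by (rule down[of 1, OF _ le12(2)]) (use min[of 0 0 "-1" 0 0] in \<open>simp_all add: steps\<close>)
  show ?thesis
  proof (cases "x4 \<ge> 0")
    case True
    then show ?thesis
      using p1 n1 p2 n2 p3 n3 p4 p5 n5 by (intro in_sign_box_nonneg[OF h]) (simp_all add: add.assoc)
  next
    case False
    then show ?thesis
      using p1 n1 p2 n2 p3 n3 n4 p5 n5
      by (intro in_sign_box_minusD[OF in_sign_box_nonneg[OF h]]) (simp_all add: add.assoc)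
  qed
qed

lemma add_eq_imp_le_half: "a + b = c \<Longrightarrow> c \<le> 2 * k + 1 \<Longrightarrow> a \<le> k \<or> b \<le> (k::int)"
  by presburger

text \<open>\<open>P\<close> stands for membership in a coset of \<open>L\<close>;
  \<open>edge\<close> and \<open>half\<close> express closure under translation by the rows of
  \<open>E\<close> and by half their sum.\<close>

lemma lattice_covering:
  fixes h k :: int and P :: "int \<Rightarrow> int \<Rightarrow> int \<Rightarrow> int \<Rightarrow> int \<Rightarrow> bool"
  assumes h: "h \<ge> 3" and k: "5 * h \<le> 2 * k + 1"
    and P: "P z1 z2 z3 z4 z5"
    and edge: "\<And>x1 x2 x3 x4 x5 d1 d2 d3 d4 d5. P x1 x2 x3 x4 x5 \<Longrightarrow>
      P (x1 - (2 * h * d1 - d4 + d5)) (x2 - (2 * h * d2 + d3 - d4)) (x3 - (2 * h * d3 - d2 - d4))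
        (x4 - (2 * h * d4 + d1 + d2 + d3 + d5)) (x5 - (2 * h * d5 - d1 - d4))"
    and half: "\<And>x1 x2 x3 x4 x5. P x1 x2 x3 x4 x5 \<Longrightarrow> P (x1 - h) (x2 - h) (x3 - (h - 1)) (x4 - (h + 2)) (x5 - (h - 1))"
  shows "\<exists>x1 x2 x3 x4 x5. P x1 x2 x3 x4 x5 \<and> \<bar>x1\<bar> + \<bar>x2\<bar> + \<bar>x3\<bar> + \<bar>x4\<bar> + \<bar>x5\<bar> \<le> k"
proof -
  define M where "M = (\<lambda>(x1, x2, x3, x4, x5). nat (bump 1 x1 + bump 1 x2 + bump 1 x3 + bump 2 x4 + bump 1 x5))"
  obtain x1 x2 x3 x4 x5 where x: "P x1 x2 x3 x4 x5"
    and min: "\<And>y1 y2 y3 y4 y5. P y1 y2 y3 y4 y5 \<Longrightarrow> M (x1, x2, x3, x4, x5) \<le> M (y1, y2, y3, y4, y5)"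
    using ex_has_least_nat[of "\<lambda>(y1, y2, y3, y4, y5). P y1 y2 y3 y4 y5" "(z1, z2, z3, z4, z5)" M] P
    by auto
  have bump_nonneg: "bump 1 x \<ge> 0" "bump 2 x \<ge> 0" for x
    by (auto simp: bump_def)
  have "bump 1 x1 + bump 1 x2 + bump 1 x3 + bump 2 x4 + bump 1 x5 \<le>
      bump 1 (x1 - (2 * h * d1 - d4 + d5)) + bump 1 (x2 - (2 * h * d2 + d3 - d4)) +
      bump 1 (x3 - (2 * h * d3 - d2 - d4)) + bump 2 (x4 - (2 * h * d4 + d1 + d2 + d3 + d5)) +
      bump 1 (x5 - (2 * h * d5 - d1 - d4))" for d1 d2 d3 d4 d5
    using min[OF edge[OF x, of d1 d4 d5 d2 d3]] bump_nonneg by (simp add: M_def nat_le_eq_zle)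
  from in_sign_box_of_bump_minimal[OF h this] obtain s1 s2 s3 s4 s5 :: int
    where s: "s1 \<in> {1,-1}" "s2 \<in> {1,-1}" "s3 \<in> {1,-1}" "s4 \<in> {1,-1}" "s5 \<in> {1,-1}"
      and b: "0 \<le> s1 * x1" "2 * (s1 * x1) \<le> 2 * h + s1 * (s5 - s4)"
        "0 \<le> s2 * x2" "2 * (s2 * x2) \<le> 2 * h + s2 * (s3 - s4)"
        "0 \<le> s3 * x3" "2 * (s3 * x3) \<le> 2 * h + s3 * (- s2 - s4)"
        "0 \<le> s4 * x4" "2 * (s4 * x4) \<le> 2 * h + s4 * (s1 + s2 + s3 + s5)"
        "0 \<le> s5 * x5" "2 * (s5 * x5) \<le> 2 * h + s5 * (- s1 - s4)"
    unfolding in_sign_box_def by blast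
  obtain t1 t2 t3 t4 t5 where t: "s1 = 2 * t1 + 1" "s2 = 2 * t2 + 1" "s3 = 2 * t3 + 1"
      "s4 = 2 * t4 + 1" "s5 = 2 * t5 + 1"
  proof -
    have "\<exists>t. s = 2 * t + 1" if "s \<in> {1, -1}" for s :: int
      using that by (auto intro: exI[of _ 0] exI[of _ "-1"])
    with s that show ?thesis by metis
  qed
  \<comment> \<open>\<open>v\<close> is \<open>sigma E / 2\<close>: half the sum of the rows plus
    \<open>t_i\<close> times row \<open>i\<close>. So one \<open>half\<close> and one
    \<open>edge\<close> step lead to \<open>x - v\<close>.\<close>
  define v1 v2 v3 v4 v5 where
    "v1 = h * s1 - t4 + t5" and "v2 = h * s2 + t3 - t4" and "v3 = h * s3 - t2 - t4 - 1"
    and "v4 = h * s4 + t1 + t2 + t3 + t5 + 2" and "v5 = h * s5 - t1 - t4 - 1"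
  have "P (x1 - v1) (x2 - v2) (x3 - v3) (x4 - v4) (x5 - v5)"
    using edge[OF half[OF x], of t1 t4 t5 t2 t3]
    by (simp add: v1_def v2_def v3_def v4_def v5_def t algebra_simps)
  moreover have "\<bar>x1\<bar> + \<bar>x2\<bar> + \<bar>x3\<bar> + \<bar>x4\<bar> + \<bar>x5\<bar> +
      (\<bar>x1 - v1\<bar> + \<bar>x2 - v2\<bar> + \<bar>x3 - v3\<bar> + \<bar>x4 - v4\<bar> + \<bar>x5 - v5\<bar>) = 5 * h"
  proof -
    \<comment> \<open>In the box \<open>x_i\<close> lies between 0 and \<open>v_i\<close>, so both
      parts add up to \<open>s_i * v_i\<close>; in the total the products of two signs cancel by
      antisymmetry.\<close>
    have abs_add: "\<bar>x\<bar> + \<bar>x - v\<bar> = s * v"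
      if "s \<in> {1, -1}" "0 \<le> s * x" "2 * (s * x) \<le> 2 * h + c" "2 * (s * v) = 2 * h + c" for s x v c :: int
      using that by auto
    have sq: "s1 * s1 = 1" "s2 * s2 = 1" "s3 * s3 = 1" "s4 * s4 = 1" "s5 * s5 = 1"
      using s by auto
    have "2 * v1 = 2 * h * s1 + (s5 - s4)" "2 * v2 = 2 * h * s2 + (s3 - s4)"
        "2 * v3 = 2 * h * s3 + (- s2 - s4)" "2 * v4 = 2 * h * s4 + (s1 + s2 + s3 + s5)"
        "2 * v5 = 2 * h * s5 + (- s1 - s4)"
      by (simp_all add: v1_def v2_def v3_def v4_def v5_def t)
    then have v: "2 * (s1 * v1) = 2 * h + s1 * (s5 - s4)" "2 * (s2 * v2) = 2 * h + s2 * (s3 - s4)"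
        "2 * (s3 * v3) = 2 * h + s3 * (- s2 - s4)" "2 * (s4 * v4) = 2 * h + s4 * (s1 + s2 + s3 + s5)"
        "2 * (s5 * v5) = 2 * h + s5 * (- s1 - s4)"
      using sq by algebra+
    have "s1 * v1 + s2 * v2 + s3 * v3 + s4 * v4 + s5 * v5 = 5 * h"
      using v by (simp add: algebra_simps)
    then show ?thesis
      unfolding abs_add[OF s(1) b(1,2) v(1), symmetric] abs_add[OF s(2) b(3,4) v(2), symmetric]
        abs_add[OF s(3) b(5,6) v(3), symmetric] abs_add[OF s(4) b(7,8) v(4), symmetric]
        abs_add[OF s(5) b(9,10) v(5), symmetric] by (simp only: ac_simps)
  qed
  then have "\<bar>x1\<bar> + \<bar>x2\<bar> + \<bar>x3\<bar> + \<bar>x4\<bar> + \<bar>x5\<bar> \<le> k \<or>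
      \<bar>x1 - v1\<bar> + \<bar>x2 - v2\<bar> + \<bar>x3 - v3\<bar> + \<bar>x4 - v4\<bar> + \<bar>x5 - v5\<bar> \<le> k"
    using k by (rule add_eq_imp_le_half)
  ultimately show ?thesis
    using x by blast
qed

section \<open>A point far from the lattice\<close>

text \<open>For nonzero \<open>d\<close>,
  \<open>2 * h * |d| - w >= (2 * w + c) * |d| - w >= w + c * |d|\<close>. The margin
  \<open>c * |d|\<close> will pay for the perturbations \<open>e\<close> of other
  coordinates.\<close>

lemma add_mult_abs_le_abs_diff_multiple:
  fixes w c h d e :: int
  assumes "0 \<le> w" "2 * w + c \<le> 2 * h"
  shows "w + c * \<bar>d\<bar> - \<bar>e\<bar> \<le> \<bar>w - (2 * h * d + e)\<bar>"
proof -
  have "w + c * \<bar>d\<bar> \<le> \<bar>w - 2 * h * d\<bar>"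
  proof (cases "d = 0")
    case False
    then have "w * 1 \<le> w * \<bar>d\<bar>"
      using assms(1) by (intro mult_left_mono) auto
    moreover have "(2 * w + c) * \<bar>d\<bar> \<le> 2 * h * \<bar>d\<bar>"
      using assms(2) by (intro mult_right_mono) auto
    moreover have "2 * h * \<bar>d\<bar> \<le> \<bar>2 * h * d\<bar>"
      by (simp add: abs_mult mult_right_mono)
    moreover have "\<bar>2 * h * d\<bar> - w \<le> \<bar>w - 2 * h * d\<bar>"
      using assms(1) by linarith
    moreover have "(2 * w + c) * \<bar>d\<bar> = w * \<bar>d\<bar> + w * \<bar>d\<bar> + c * \<bar>d\<bar>"
      by (simp add: algebra_simps)
    ultimately show ?thesis by linarith
  qed (use assms in simp)
  then show ?thesis by linarith
qed

text \<open>Row \<open>i\<close> perturbs one coordinate per neighbour of \<open>i\<close>, so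
  margins equal to the degrees (4 at the centre, 2 elsewhere) absorb all errors. They fit because
  \<open>2 * t + 4 <= 2 * h\<close>.\<close>

lemma edge_lattice_far:
  fixes t h d1 d2 d3 d4 d5 :: int
  assumes "t \<ge> 1" and h: "h = 2 * t + 1"
  shows "5 * t + 2 \<le> \<bar>t + 1 - (2 * h * d1 - d4 + d5)\<bar> + \<bar>t + 1 - (2 * h * d2 + d3 - d4)\<bar> +
    \<bar>t - (2 * h * d3 - d2 - d4)\<bar> + \<bar>t - (2 * h * d4 + d1 + d2 + d3 + d5)\<bar> + \<bar>t - (2 * h * d5 - d1 - d4)\<bar>"
proof -
  have 2: "w + 2 * \<bar>d\<bar> - \<bar>e\<bar> \<le> \<bar>w - (2 * h * d + e)\<bar>" if "w = t \<or> w = t + 1" for w d e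
    using assms that by (intro add_mult_abs_le_abs_diff_multiple) auto
  have "t + 4 * \<bar>d4\<bar> - \<bar>d1 + d2 + d3 + d5\<bar> \<le> \<bar>t - (2 * h * d4 + (d1 + d2 + d3 + d5))\<bar>"
    using assms by (intro add_mult_abs_le_abs_diff_multiple) auto
  moreover have "\<bar>d1 + d2 + d3 + d5\<bar> \<le> \<bar>d1\<bar> + \<bar>d2\<bar> + \<bar>d3\<bar> + \<bar>d5\<bar>" "\<bar>d5 - d4\<bar> \<le> \<bar>d4\<bar> + \<bar>d5\<bar>"
    "\<bar>d3 - d4\<bar> \<le> \<bar>d3\<bar> + \<bar>d4\<bar>" "\<bar>- d2 - d4\<bar> \<le> \<bar>d2\<bar> + \<bar>d4\<bar>" "\<bar>- d1 - d4\<bar> \<le> \<bar>d1\<bar> + \<bar>d4\<bar>"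
    by linarith+
  ultimately show ?thesis
    using 2[of "t + 1" d1 "d5 - d4"] 2[of "t + 1" d2 "d3 - d4"] 2[of t d3 "- d2 - d4"] 2[of t d5 "- d1 - d4"]
    by (simp add: algebra_simps)
qed

text \<open>The vectors \<open>sigma E / 2\<close> have norm
  \<open>5 * h = 2 * (5 * t + 2) + 1\<close>, hence distance at least \<open>5 * t + 3\<close>. Each
  further copy of a row in the same direction gains \<open>2 * h >= 6\<close> and loses at most 4 at
  its neighbours.\<close>

lemma half_lattice_far:
  fixes t h d1 d2 d3 d4 d5 :: int
  assumes "t \<ge> 1" and h: "h = 2 * t + 1"
  shows "5 * t + 2 \<le> \<bar>t + 1 - (h + (2 * h * d1 - d4 + d5))\<bar> + \<bar>t + 1 - (h + (2 * h * d2 + d3 - d4))\<bar> +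
    \<bar>t - (h - 1 + (2 * h * d3 - d2 - d4))\<bar> + \<bar>t - (h + 2 + (2 * h * d4 + d1 + d2 + d3 + d5))\<bar> +
    \<bar>t - (h - 1 + (2 * h * d5 - d1 - d4))\<bar>"
proof -
  \<comment> \<open>The sign of \<open>d\<close> selects the side of the absolute value. Below,
    \<open>q_i\<close> replaces \<open>h * d_i\<close> and is known only through
    \<open>h >= 3\<close>, so all 32 sign patterns are linear.\<close>
  have mult: "(d \<ge> 0 \<and> 3 * d \<le> h * d \<and> - y \<le> \<bar>y\<bar>) \<or> (d \<le> -1 \<and> h * d + h \<le> 3 * d + 3 \<and> y \<le> \<bar>y\<bar>)" for d y :: int
  proof (cases "d \<ge> 0")
    case True
    then show ?thesis using assms mult_right_mono[of 3 h d] abs_ge_minus_self[of y] by simp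
  next
    case False
    then show ?thesis using assms mult_right_mono_neg[of 3 h "d + 1"] by (simp add: algebra_simps)
  qed
  have "5 * t + 2 \<le> a1 + a2 + a3 + a4 + a5"
    if "d1 \<ge> 0 \<and> 3 * d1 \<le> q1 \<and> - (t + 1 - (h + (2 * q1 - d4 + d5))) \<le> a1 \<or>
        d1 \<le> -1 \<and> q1 + h \<le> 3 * d1 + 3 \<and> t + 1 - (h + (2 * q1 - d4 + d5)) \<le> a1"
      "d2 \<ge> 0 \<and> 3 * d2 \<le> q2 \<and> - (t + 1 - (h + (2 * q2 + d3 - d4))) \<le> a2 \<or>
        d2 \<le> -1 \<and> q2 + h \<le> 3 * d2 + 3 \<and> t + 1 - (h + (2 * q2 + d3 - d4)) \<le> a2"
      "d3 \<ge> 0 \<and> 3 * d3 \<le> q3 \<and> - (t - (h - 1 + (2 * q3 - d2 - d4))) \<le> a3 \<or>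
        d3 \<le> -1 \<and> q3 + h \<le> 3 * d3 + 3 \<and> t - (h - 1 + (2 * q3 - d2 - d4)) \<le> a3"
      "d4 \<ge> 0 \<and> 3 * d4 \<le> q4 \<and> - (t - (h + 2 + (2 * q4 + d1 + d2 + d3 + d5))) \<le> a4 \<or>
        d4 \<le> -1 \<and> q4 + h \<le> 3 * d4 + 3 \<and> t - (h + 2 + (2 * q4 + d1 + d2 + d3 + d5)) \<le> a4"
      "d5 \<ge> 0 \<and> 3 * d5 \<le> q5 \<and> - (t - (h - 1 + (2 * q5 - d1 - d4))) \<le> a5 \<or>
        d5 \<le> -1 \<and> q5 + h \<le> 3 * d5 + 3 \<and> t - (h - 1 + (2 * q5 - d1 - d4)) \<le> a5"
    for a1 a2 a3 a4 a5 q1 q2 q3 q4 q5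
    using that h \<open>t \<ge> 1\<close> by (elim disjE conjE; linarith)
  from this[OF mult mult mult mult mult] show ?thesis
    unfolding mult.assoc[of 2 h] .
qed

section \<open>Distances in circulant graphs\<close>

text \<open>Each arc changes one coefficient by 1; such changes may cancel, hence only an
  inequality.\<close>

lemma awalk_to_combination:
  assumes "finite S" "pre_digraph.awalk (circulant_graph n S) u p v"
  shows "\<exists>x. [(\<Sum>g\<in>S. x g * g) = v - u] (mod n) \<and> (\<Sum>g\<in>S. \<bar>x g\<bar>) \<le> int (length p)"
  using assms(2)
proof (induction p arbitrary: u)
  case Nil
  then show ?case
    by (intro exI[of _ "\<lambda>_. 0"]) (auto simp: pre_digraph.awalk_def pre_digraph.cas.simps)
next
  case (Cons a p)
  define u' where "u' = snd a"
  have a: "a = (u, u')" "a \<in> arcs (circulant_graph n S)"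
    and p: "pre_digraph.awalk (circulant_graph n S) u' p v"
    using Cons.prems
    by (auto simp: pre_digraph.awalk_def pre_digraph.cas.simps circulant_graph_def u'_def)
  obtain x where x: "[(\<Sum>g\<in>S. x g * g) = v - u'] (mod n)" "(\<Sum>g\<in>S. \<bar>x g\<bar>) \<le> int (length p)"
    using Cons.IH[OF p] by blast
  obtain g e :: int where g: "g \<in> S" and e: "\<bar>e\<bar> = 1" and step: "[u' - u = e * g] (mod n)"
  proof -
    from a obtain g where "g \<in> S" "[u' - u = g] (mod n) \<or> [u' - u = - g] (mod n)"
      by (auto simp: circulant_graph_def)
    then show thesis
      using that[of g 1] that[of g "-1"] by auto
  qed
  define y where "y = x(g := x g + e)"
  have "(\<Sum>g\<in>S. y g * g) = (\<Sum>g\<in>S. x g * g) + e * g"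
    using assms(1) g by (simp add: y_def sum.remove[OF assms(1) g] algebra_simps)
  moreover have "[(\<Sum>g\<in>S. x g * g) + e * g = (v - u') + (u' - u)] (mod n)"
    using cong_add[OF x(1) cong_sym[OF step]] .
  moreover have "(\<Sum>g\<in>S. \<bar>y g\<bar>) \<le> (\<Sum>g\<in>S. \<bar>x g\<bar>) + 1"
    using assms(1) g e by (simp add: y_def sum.remove[OF assms(1) g])
  ultimately show ?case
    using x(2) by (intro exI[of _ y]) simp
qed

text \<open>A step along a generator with nonzero coefficient, in the direction of its sign, lowers
  the norm by 1.\<close>

lemma combination_to_awalk:
  assumes "finite S" "n > 0" "u \<in> {0..<n}" "v \<in> {0..<n}"
    and "[(\<Sum>g\<in>S. x g * g) = v - u] (mod n)"
  shows "\<exists>p. pre_digraph.awalk (circulant_graph n S) u p v \<and> int (length p) = (\<Sum>g\<in>S. \<bar>x g\<bar>)"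
  using assms(3-)
proof (induction "nat (\<Sum>g\<in>S. \<bar>x g\<bar>)" arbitrary: x u)
  case 0
  then have "(\<Sum>g\<in>S. \<bar>x g\<bar>) = 0"
    by (simp add: sum_nonneg order_antisym)
  moreover from this have "\<forall>g\<in>S. x g = 0"
    using assms(1) by (simp add: sum_nonneg_eq_0_iff)
  moreover from this have "[v = u] (mod n)"
    using 0(4) by (simp add: cong_iff_dvd_diff dvd_diff_commute)
  then have "u = v"
    using 0(2,3) by (simp add: cong_def)
  ultimately show ?case
    using 0(2) by (intro exI[of _ "[]"])
      (simp add: pre_digraph.awalk_def pre_digraph.cas.simps circulant_graph_def)
next
  case (Suc l)
  have "\<exists>g\<in>S. x g \<noteq> 0"
  proof (rule ccontr)
    assume "\<not> ?thesis"
    then have "(\<Sum>g\<in>S. \<bar>x g\<bar>) = 0" by simp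
    with Suc(2) show False by simp
  qed
  then obtain g where g: "g \<in> S" "x g \<noteq> 0" by blast
  define y u' where "y = x(g := x g - sgn (x g))" and "u' = (u + sgn (x g) * g) mod n"
  have abs_y: "\<bar>x g - sgn (x g)\<bar> = \<bar>x g\<bar> - 1"
    using g(2) by (auto simp: sgn_if)
  then have norm_y: "(\<Sum>g\<in>S. \<bar>y g\<bar>) = (\<Sum>g\<in>S. \<bar>x g\<bar>) - 1"
    using assms(1) g by (simp add: y_def sum.remove[OF assms(1) g(1)])
  have "(\<Sum>g\<in>S. y g * g) = (\<Sum>g\<in>S. x g * g) - sgn (x g) * g"
    using assms(1) g by (simp add: y_def sum.remove[OF assms(1) g(1)] algebra_simps)
  moreover have u': "[u' = u + sgn (x g) * g] (mod n)"
    by (simp add: u'_def cong_def)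
  moreover have "v - u - sgn (x g) * g = v - (u + sgn (x g) * g)" by simp
  ultimately have "[(\<Sum>g\<in>S. y g * g) = v - u'] (mod n)"
    using cong_diff[OF Suc(5) cong_refl[of "sgn (x g) * g"]] cong_diff[OF cong_refl[of v] cong_sym[OF u']]
    by (metis cong_trans)
  moreover have "u' \<in> {0..<n}"
    using assms(2) by (simp add: u'_def)
  moreover have "l = nat (\<Sum>g\<in>S. \<bar>y g\<bar>)"
    using Suc(2) norm_y by simp
  ultimately obtain p where p: "pre_digraph.awalk (circulant_graph n S) u' p v" "int (length p) = (\<Sum>g\<in>S. \<bar>y g\<bar>)"
    using Suc(1) Suc(4) by blast
  have "[u' - u = sgn (x g) * g] (mod n)"
    using cong_diff[OF u' cong_refl[of u]] by simp
  moreover have "sgn (x g) = 1 \<or> sgn (x g) = -1"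
    using g(2) by (auto simp: sgn_if)
  ultimately have "(u, u') \<in> arcs (circulant_graph n S)"
    using g(1) Suc(3) \<open>u' \<in> {0..<n}\<close> by (auto simp: circulant_graph_def)
  then have "pre_digraph.awalk (circulant_graph n S) u ((u, u') # p) v"
    using p(1) Suc(3) by (auto simp: pre_digraph.awalk_def pre_digraph.cas.simps circulant_graph_def)
  then show ?case
    using p(2) norm_y by (intro exI[of _ "(u, u') # p"]) simp
qed

text \<open>The distance depends only on \<open>v - u\<close>, so one hard residue \<open>r\<close>,
  tested from vertex 0, gives the lower bound.\<close>

lemma diameter_circulant_graph_eqI:
  fixes k :: int
  assumes "finite S" "n > 0"
    and upper: "\<And>r. \<exists>x. [(\<Sum>g\<in>S. x g * g) = r] (mod n) \<and> (\<Sum>g\<in>S. \<bar>x g\<bar>) \<le> k"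
    and lower: "\<And>x. [(\<Sum>g\<in>S. x g * g) = r] (mod n) \<Longrightarrow> k \<le> (\<Sum>g\<in>S. \<bar>x g\<bar>)"
  shows "diameter (circulant_graph n S) = ereal (real_of_int k)"
proof -
  interpret pseudo_graph "circulant_graph n S"
    by (rule pseudo_graph_circulant_graph)
  have cost: "awalk_cost (\<lambda>_. 1) p = real (length p)" for p :: "(int \<times> int) list"
    by (simp add: awalk_cost_def sum_list_triv)
  have verts: "verts (circulant_graph n S) = {0..<n}"
    by (simp add: circulant_graph_def)
  have le: "graph_dist (circulant_graph n S) u v \<le> ereal (real_of_int k)"
    if uv: "u \<in> {0..<n}" "v \<in> {0..<n}" for u v
  proof -
    obtain x where x: "[(\<Sum>g\<in>S. x g * g) = v - u] (mod n)" "(\<Sum>g\<in>S. \<bar>x g\<bar>) \<le> k"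
      using upper by blast
    obtain p where p: "awalk u p v" "int (length p) = (\<Sum>g\<in>S. \<bar>x g\<bar>)"
      using combination_to_awalk[OF assms(1,2) uv x(1)] by blast
    have "\<mu> (\<lambda>_. 1) u v \<le> ereal (real (length p))"
      using min_cost_le_walk_cost[OF p(1), of "\<lambda>_. 1"] by (simp add: cost)
    also have "\<dots> \<le> ereal (real_of_int k)"
      using p(2) x(2) by simp
    finally show ?thesis by (simp add: graph_dist_def)
  qed
  have ge: "ereal (real_of_int k) \<le> graph_dist (circulant_graph n S) 0 (r mod n)"
    unfolding graph_dist_def \<mu>_def
  proof (rule INF_greatest)
    fix p assume "p \<in> {p. awalk 0 p (r mod n)}"
    then obtain x where "[(\<Sum>g\<in>S. x g * g) = r mod n - 0] (mod n)" "(\<Sum>g\<in>S. \<bar>x g\<bar>) \<le> int (length p)"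
      using awalk_to_combination[OF assms(1)] by blast
    then have "k \<le> int (length p)"
      using lower[of x] by (simp add: cong_def)
    then show "ereal (real_of_int k) \<le> ereal (awalk_cost (\<lambda>_. 1) p)"
      by (simp add: cost)
  qed
  show ?thesis
    unfolding diameter_def verts
  proof (rule antisym)
    show "(SUP (u, v)\<in>{0..<n} \<times> {0..<n}. graph_dist (circulant_graph n S) u v) \<le> ereal (real_of_int k)"
      using le by (intro SUP_least) auto
    show "ereal (real_of_int k) \<le> (SUP (u, v)\<in>{0..<n} \<times> {0..<n}. graph_dist (circulant_graph n S) u v)"
      using ge assms(2) by (intro SUP_upper2[of "(0, r mod n)"]) auto
  qed
qed

section \<open>The lattice of the circulant graph\<close>

text \<open>The order and the generators as polynomials in \<open>m\<close>, where \<open>k = 15 m + 7\<close>.\<close>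

definition circ_order :: "int \<Rightarrow> int" where
  "circ_order m = 124416 * m ^ 5 + 311040 * m ^ 4 + 316224 * m ^ 3 + 163296 * m ^ 2 + 42798 * m + 4551"

definition circ_gen2 :: "int \<Rightarrow> int" where
  "circ_gen2 m = 10368 * m ^ 4 + 20736 * m ^ 3 + 15912 * m ^ 2 + 5544 * m + 739"

definition circ_gen3 :: "int \<Rightarrow> int" where
  "circ_gen3 m = 41472 * m ^ 5 + 100224 * m ^ 4 + 97920 * m ^ 3 + 48216 * m ^ 2 + 11922 * m + 1178"

definition circ_gen4 :: "int \<Rightarrow> int" where
  "circ_gen4 m = 41472 * m ^ 5 + 100224 * m ^ 4 + 98784 * m ^ 3 + 49512 * m ^ 2 + 12588 * m + 1295"

definition circ_gen5 :: "int \<Rightarrow> int" where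
  "circ_gen5 m = 41472 * m ^ 5 + 100224 * m ^ 4 + 98784 * m ^ 3 + 49512 * m ^ 2 + 12600 * m + 1301"

lemmas circ_defs = circ_order_def circ_gen2_def circ_gen3_def circ_gen4_def circ_gen5_def

definition circ_value :: "int \<Rightarrow> int \<Rightarrow> int \<Rightarrow> int \<Rightarrow> int \<Rightarrow> int \<Rightarrow> int" where
  "circ_value m x1 x2 x3 x4 x5 =
    x1 + circ_gen2 m * x2 + circ_gen3 m * x3 + circ_gen4 m * x4 + circ_gen5 m * x5"

text \<open>The factors 0, 1, \<open>4 * m + 2\<close>, \<open>4 * m + 1\<close>,
  \<open>4 * m + 2\<close> are the values of the rows of \<open>E\<close> divided by the order; half
  their sum is the \<open>6 * m + 3\<close> of \<open>circ_value_half\<close>.\<close>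

lemma circ_value_edge:
  assumes "h = 6 * m + 3"
  shows "circ_value m (2 * h * d1 - d4 + d5) (2 * h * d2 + d3 - d4) (2 * h * d3 - d2 - d4)
      (2 * h * d4 + d1 + d2 + d3 + d5) (2 * h * d5 - d1 - d4) =
    circ_order m * (d2 + (4 * m + 2) * d3 + (4 * m + 1) * d4 + (4 * m + 2) * d5)"
  unfolding assms circ_value_def circ_defs by algebra

lemma circ_value_half:
  assumes "h = 6 * m + 3"
  shows "circ_value m h h (h - 1) (h + 2) (h - 1) = circ_order m * (6 * m + 3)"
  unfolding assms circ_value_def circ_defs by algebra

lemma circ_value_diff:
  "circ_value m (x1 - y1) (x2 - y2) (x3 - y3) (x4 - y4) (x5 - y5) =
    circ_value m x1 x2 x3 x4 x5 - circ_value m y1 y2 y3 y4 y5"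
  by (simp add: circ_value_def algebra_simps)

text \<open>The lower bound needs that no vectors outside \<open>L\<close> vanish modulo the order.
  The disjuncts are the two cosets of the row lattice in \<open>L\<close>.\<close>

lemma circ_value_dvd_imp_lattice:
  assumes h: "h = 6 * m + 3" and dvd: "circ_order m dvd circ_value m x1 x2 x3 x4 x5"
  shows "\<exists>d1 d2 d3 d4 d5.
    (x1 = 2 * h * d1 - d4 + d5 \<and> x2 = 2 * h * d2 + d3 - d4 \<and> x3 = 2 * h * d3 - d2 - d4 \<and>
      x4 = 2 * h * d4 + d1 + d2 + d3 + d5 \<and> x5 = 2 * h * d5 - d1 - d4) \<or>
    (x1 = h + (2 * h * d1 - d4 + d5) \<and> x2 = h + (2 * h * d2 + d3 - d4) \<and>
      x3 = h - 1 + (2 * h * d3 - d2 - d4) \<and>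
      x4 = h + 2 + (2 * h * d4 + d1 + d2 + d3 + d5) \<and> x5 = h - 1 + (2 * h * d5 - d1 - d4))"
proof -
  obtain z where z: "x1 + circ_gen2 m * x2 + circ_gen3 m * x3 + circ_gen4 m * x4 + circ_gen5 m * x5 = circ_order m * z"
    using dvd by (auto simp: circ_value_def dvd_def)
  \<comment> \<open>the coordinates of \<open>x\<close> in the basis \<open>(e\<^sub>1 + \<dots> + e\<^sub>5) / 2, e\<^sub>2, e\<^sub>3, e\<^sub>4, e\<^sub>5\<close> of \<open>L\<close>, found by solving
    for the generators \<open>(n,0,0,0,0), (-g\<^sub>2,1,0,0,0), \<dots>\<close> of \<open>L\<close>\<close>
  define c1 where "c1 = (20736 * m ^ 4 + 41472 * m ^ 3 + 31680 * m ^ 2 + 10944 * m + 1441) * z +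
    (- 1728 * m ^ 3 - 2592 * m ^ 2 - 1332 * m - 234) * x2 +
    (- 6912 * m ^ 4 - 13248 * m ^ 3 - 9600 * m ^ 2 - 3100 * m - 373) * x3 +
    (- 6912 * m ^ 4 - 13248 * m ^ 3 - 9744 * m ^ 2 - 3244 * m - 410) * x4 +
    (- 6912 * m ^ 4 - 13248 * m ^ 3 - 9744 * m ^ 2 - 3244 * m - 412) * x5"
  define c2 where "c2 = (- 10368 * m ^ 4 - 20736 * m ^ 3 - 15912 * m ^ 2 - 5544 * m - 738) * z +
    (864 * m ^ 3 + 1296 * m ^ 2 + 672 * m + 120) * x2 +
    (3456 * m ^ 4 + 6624 * m ^ 3 + 4824 * m ^ 2 + 1572 * m + 191) * x3 +
    (3456 * m ^ 4 + 6624 * m ^ 3 + 4896 * m ^ 2 + 1644 * m + 210) * x4 +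
    (3456 * m ^ 4 + 6624 * m ^ 3 + 4896 * m ^ 2 + 1644 * m + 211) * x5"
  define c3 where "c3 = (- 10368 * m ^ 4 - 20736 * m ^ 3 - 15912 * m ^ 2 - 5556 * m - 745) * z +
    (864 * m ^ 3 + 1296 * m ^ 2 + 672 * m + 121) * x2 +
    (3456 * m ^ 4 + 6624 * m ^ 3 + 4824 * m ^ 2 + 1576 * m + 193) * x3 +
    (3456 * m ^ 4 + 6624 * m ^ 3 + 4896 * m ^ 2 + 1648 * m + 212) * x4 +
    (3456 * m ^ 4 + 6624 * m ^ 3 + 4896 * m ^ 2 + 1648 * m + 213) * x5"
  define c4 where "c4 = (- 10368 * m ^ 4 - 21600 * m ^ 3 - 17208 * m ^ 2 - 6198 * m - 850) * z +
    (864 * m ^ 3 + 1368 * m ^ 2 + 744 * m + 138) * x2 +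
    (3456 * m ^ 4 + 6912 * m ^ 3 + 5232 * m ^ 2 + 1762 * m + 220) * x3 +
    (3456 * m ^ 4 + 6912 * m ^ 3 + 5304 * m ^ 2 + 1840 * m + 242) * x4 +
    (3456 * m ^ 4 + 6912 * m ^ 3 + 5304 * m ^ 2 + 1840 * m + 243) * x5"
  define c5 where "c5 = (- 10368 * m ^ 4 - 19872 * m ^ 3 - 14616 * m ^ 2 - 4878 * m - 622) * z +
    (864 * m ^ 3 + 1224 * m ^ 2 + 600 * m + 101) * x2 +
    (3456 * m ^ 4 + 6336 * m ^ 3 + 4416 * m ^ 2 + 1378 * m + 161) * x3 +
    (3456 * m ^ 4 + 6336 * m ^ 3 + 4488 * m ^ 2 + 1444 * m + 177) * x4 +
    (3456 * m ^ 4 + 6336 * m ^ 3 + 4488 * m ^ 2 + 1444 * m + 178) * x5"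
  have x1: "x1 = circ_order m * z - (circ_gen2 m * x2 + circ_gen3 m * x3 + circ_gen4 m * x4 + circ_gen5 m * x5)"
    using z by simp
  have x: "x1 = h * c1 - c4 + c5" "x2 = h * c1 + 2 * h * c2 + c3 - c4" "x3 = (h - 1) * c1 - c2 + 2 * h * c3 - c4"
    "x4 = (h + 2) * c1 + c2 + c3 + 2 * h * c4 + c5" "x5 = (h - 1) * c1 - c4 + 2 * h * c5"
    unfolding h x1 c1_def c2_def c3_def c4_def c5_def circ_defs by algebra+
  show ?thesis
  \<comment> \<open>Twice the half-sum is the sum of all rows, so \<open>d\<close> is added to every
    row coefficient and the parity of \<open>c1\<close> selects the coset.\<close>
  proof (cases "even c1")
    case True
    then obtain d where d: "c1 = 2 * d" by (auto elim: evenE)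
    show ?thesis
      by (rule exI[of _ d], rule exI[of _ "c2 + d"], rule exI[of _ "c3 + d"], rule exI[of _ "c4 + d"],
          rule exI[of _ "c5 + d"], rule disjI1) (simp add: x d algebra_simps)
  next
    case False
    then obtain d where d: "c1 = 2 * d + 1" by (auto elim: oddE)
    show ?thesis
      by (rule exI[of _ d], rule exI[of _ "c2 + d"], rule exI[of _ "c3 + d"], rule exI[of _ "c4 + d"],
          rule exI[of _ "c5 + d"], rule disjI2) (simp add: x d algebra_simps)
  qed
qed

lemma circ_value_covering:
  assumes m: "m \<ge> 0"
  shows "\<exists>x1 x2 x3 x4 x5. [circ_value m x1 x2 x3 x4 x5 = r] (mod circ_order m) \<and>
    \<bar>x1\<bar> + \<bar>x2\<bar> + \<bar>x3\<bar> + \<bar>x4\<bar> + \<bar>x5\<bar> \<le> 15 * m + 7"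
proof (rule lattice_covering[where h = "6 * m + 3"])
  show "[circ_value m r 0 0 0 0 = r] (mod circ_order m)"
    by (simp add: circ_value_def)
  have *: "[a - circ_order m * b = r] (mod circ_order m)" if "[a = r] (mod circ_order m)" for a b
    using that cong_diff[of a r "circ_order m" "circ_order m * b" 0] by (simp add: cong_0_iff)
  fix x1 x2 x3 x4 x5 d1 d2 d3 d4 d5
  assume x: "[circ_value m x1 x2 x3 x4 x5 = r] (mod circ_order m)"
  show "[circ_value m (x1 - (2 * (6 * m + 3) * d1 - d4 + d5)) (x2 - (2 * (6 * m + 3) * d2 + d3 - d4))
      (x3 - (2 * (6 * m + 3) * d3 - d2 - d4)) (x4 - (2 * (6 * m + 3) * d4 + d1 + d2 + d3 + d5))
      (x5 - (2 * (6 * m + 3) * d5 - d1 - d4)) = r] (mod circ_order m)"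
    unfolding circ_value_diff circ_value_edge[OF refl] using x by (rule *)
  show "[circ_value m (x1 - (6 * m + 3)) (x2 - (6 * m + 3)) (x3 - (6 * m + 3 - 1)) (x4 - (6 * m + 3 + 2))
      (x5 - (6 * m + 3 - 1)) = r] (mod circ_order m)"
    unfolding circ_value_diff circ_value_half[OF refl] using x by (rule *)
qed (use m in simp_all)

lemma circ_value_far:
  assumes m: "m \<ge> 0" and t: "t = 3 * m + 1"
    and "[circ_value m x1 x2 x3 x4 x5 = circ_value m (t + 1) (t + 1) t t t] (mod circ_order m)"
  shows "15 * m + 7 \<le> \<bar>x1\<bar> + \<bar>x2\<bar> + \<bar>x3\<bar> + \<bar>x4\<bar> + \<bar>x5\<bar>"
proof -
  define h where "h = 6 * m + 3"
  have h: "t \<ge> 1" "h = 2 * t + 1"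
    using m t by (simp_all add: h_def)
  \<comment> \<open>The norm of \<open>x\<close> is the distance from the far point to the lattice
    vector obtained by subtracting \<open>x\<close> from it.\<close>
  have "circ_order m dvd circ_value m (t + 1 - x1) (t + 1 - x2) (t - x3) (t - x4) (t - x5)"
    using assms(3) unfolding circ_value_diff by (simp add: cong_iff_dvd_diff dvd_diff_commute)
  from circ_value_dvd_imp_lattice[OF h_def this] obtain d1 d2 d3 d4 d5 where
    "(t + 1 - x1 = 2 * h * d1 - d4 + d5 \<and> t + 1 - x2 = 2 * h * d2 + d3 - d4 \<and> t - x3 = 2 * h * d3 - d2 - d4 \<and>
      t - x4 = 2 * h * d4 + d1 + d2 + d3 + d5 \<and> t - x5 = 2 * h * d5 - d1 - d4) \<or>
    (t + 1 - x1 = h + (2 * h * d1 - d4 + d5) \<and> t + 1 - x2 = h + (2 * h * d2 + d3 - d4) \<and>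
      t - x3 = h - 1 + (2 * h * d3 - d2 - d4) \<and>
      t - x4 = h + 2 + (2 * h * d4 + d1 + d2 + d3 + d5) \<and> t - x5 = h - 1 + (2 * h * d5 - d1 - d4))"
    by blast
  then have "5 * t + 2 \<le> \<bar>t + 1 - (t + 1 - x1)\<bar> + \<bar>t + 1 - (t + 1 - x2)\<bar> + \<bar>t - (t - x3)\<bar> + \<bar>t - (t - x4)\<bar> + \<bar>t - (t - x5)\<bar>"
  proof (elim disjE conjE)
    assume eq: "t + 1 - x1 = 2 * h * d1 - d4 + d5" "t + 1 - x2 = 2 * h * d2 + d3 - d4" "t - x3 = 2 * h * d3 - d2 - d4"
      "t - x4 = 2 * h * d4 + d1 + d2 + d3 + d5" "t - x5 = 2 * h * d5 - d1 - d4"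
    show ?thesis unfolding eq by (rule edge_lattice_far[OF h])
  next
    assume eq: "t + 1 - x1 = h + (2 * h * d1 - d4 + d5)" "t + 1 - x2 = h + (2 * h * d2 + d3 - d4)"
      "t - x3 = h - 1 + (2 * h * d3 - d2 - d4)"
      "t - x4 = h + 2 + (2 * h * d4 + d1 + d2 + d3 + d5)" "t - x5 = h - 1 + (2 * h * d5 - d1 - d4)"
    show ?thesis unfolding eq by (rule half_lattice_far[OF h])
  qed
  then show ?thesis by (simp add: t)
qed

text \<open>Distinctness modulo the order turns sums over the generating set into five terms. All
  differences have nonnegative coefficients in \<open>m\<close>.\<close>

lemma circ_gens_less:
  assumes "m \<ge> 0"
  shows "1 < circ_gen2 m" "circ_gen2 m < circ_gen3 m" "circ_gen3 m < circ_gen4 m"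
    "circ_gen4 m < circ_gen5 m" "circ_gen5 m < circ_order m"
proof -
  have "0 \<le> m ^ 2" "0 \<le> m ^ 3" "0 \<le> m ^ 4" "0 \<le> m ^ 5"
    using assms by simp_all
  with assms show "1 < circ_gen2 m" "circ_gen2 m < circ_gen3 m" "circ_gen3 m < circ_gen4 m"
    "circ_gen4 m < circ_gen5 m" "circ_gen5 m < circ_order m"
    unfolding circ_defs by linarith+
qed

section \<open>The diameter and the closed forms in \<open>k\<close>\<close>

lemma diameter_circ_graph:
  assumes m: "m \<ge> 0"
  shows "diameter (circulant_graph (circ_order m) {1, circ_gen2 m, circ_gen3 m, circ_gen4 m, circ_gen5 m}) =
    ereal (real_of_int (15 * m + 7))"
proof (rule diameter_circulant_graph_eqI)
  note less = circ_gens_less[OF m]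
  have sum: "(\<Sum>g\<in>{1, circ_gen2 m, circ_gen3 m, circ_gen4 m, circ_gen5 m}. f g) =
      f 1 + f (circ_gen2 m) + f (circ_gen3 m) + f (circ_gen4 m) + f (circ_gen5 m)" for f :: "int \<Rightarrow> int"
    using less by simp
  show "circ_order m > 0" using less by linarith
  show "\<exists>x. [(\<Sum>g\<in>{1, circ_gen2 m, circ_gen3 m, circ_gen4 m, circ_gen5 m}. x g * g) = r] (mod circ_order m) \<and>
      (\<Sum>g\<in>{1, circ_gen2 m, circ_gen3 m, circ_gen4 m, circ_gen5 m}. \<bar>x g\<bar>) \<le> 15 * m + 7" for r
  proof -
    obtain x1 x2 x3 x4 x5 where x: "[circ_value m x1 x2 x3 x4 x5 = r] (mod circ_order m)"
        "\<bar>x1\<bar> + \<bar>x2\<bar> + \<bar>x3\<bar> + \<bar>x4\<bar> + \<bar>x5\<bar> \<le> 15 * m + 7"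
      using circ_value_covering[OF m] by blast
    define y where "y = (\<lambda>g. if g = 1 then x1 else if g = circ_gen2 m then x2 else if g = circ_gen3 m then x3
      else if g = circ_gen4 m then x4 else x5)"
    have "y 1 = x1" "y (circ_gen2 m) = x2" "y (circ_gen3 m) = x3" "y (circ_gen4 m) = x4" "y (circ_gen5 m) = x5"
      using less by (auto simp: y_def)
    with x show ?thesis
      unfolding sum by (intro exI[of _ y]) (simp add: circ_value_def mult.commute)
  qed
  show "15 * m + 7 \<le> (\<Sum>g\<in>{1, circ_gen2 m, circ_gen3 m, circ_gen4 m, circ_gen5 m}. \<bar>x g\<bar>)"
    if "[(\<Sum>g\<in>{1, circ_gen2 m, circ_gen3 m, circ_gen4 m, circ_gen5 m}. x g * g) =
      circ_value m (3 * m + 1 + 1) (3 * m + 1 + 1) (3 * m + 1) (3 * m + 1) (3 * m + 1)] (mod circ_order m)" for x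
    using that unfolding sum
    by (intro circ_value_far[OF m refl]) (simp add: circ_value_def mult.commute)
qed simp

text \<open>Substituting \<open>k = 15 * m + 7\<close> clears all denominators; this is where the
  congruence on \<open>k\<close> enters.\<close>

lemma of_int_circ:
  fixes m :: int
  defines "k \<equiv> rat_of_int (15 * m + 7)"
  shows "rat_of_int (circ_order m) = L_CC_10 k" "rat_of_int (circ_gen2 m) = gen2 k"
    "rat_of_int (circ_gen3 m) = gen3 k" "rat_of_int (circ_gen4 m) = gen4 k" "rat_of_int (circ_gen5 m) = gen5 k"
  unfolding circ_defs L_CC_10_def gen2_def gen3_def gen4_def gen5_def k_def
  by (simp_all add: field_simps; algebra)+

theorem theorem6:
  fixes k :: int
  assumes "k > 0" and "[k = 7] (mod 15)"
  shows "\<exists>n::int. n > 0 \<and> rat_of_int n = L_CC_10 (rat_of_int k) \<and>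
    (\<exists>S. S \<subseteq> {0..<n} \<and> card S = 5 \<and>
         diameter (circulant_graph n S) = ereal (real_of_int k)) \<and>
    (\<exists>g1 g2 g3 g4 g5 :: int.
         g1 = 1 \<and>
         rat_of_int g2 = gen2 (rat_of_int k) \<and>
         rat_of_int g3 = gen3 (rat_of_int k) \<and>
         rat_of_int g4 = gen4 (rat_of_int k) \<and>
         rat_of_int g5 = gen5 (rat_of_int k) \<and>
         card ((\<lambda>g. g mod n) ` {g1, g2, g3, g4, g5}) = 5 \<and>
         diameter (circulant_graph n ((\<lambda>g. g mod n) ` {g1, g2, g3, g4, g5})) = ereal (real_of_int k))"
proof -
  define m where "m = k div 15"
  have "k mod 15 = 7"
    using assms(2) by (simp add: cong_def)
  then have k: "k = 15 * m + 7" and m: "m \<ge> 0"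
    using assms(1) by (simp_all add: m_def) presburger
  note less = circ_gens_less[OF m]
  define S where "S = {1, circ_gen2 m, circ_gen3 m, circ_gen4 m, circ_gen5 m}"
  have S: "S \<subseteq> {0..<circ_order m}" "card S = 5"
    using less by (auto simp: S_def)
  have image: "(\<lambda>g. g mod circ_order m) ` S = S"
    using S(1) by (force simp: image_def)
  have diam: "diameter (circulant_graph (circ_order m) S) = ereal (real_of_int k)"
    unfolding S_def k by (rule diameter_circ_graph[OF m])
  show ?thesis
  proof (intro exI conjI)
    show "circ_order m > 0"
      using less by linarith
    show "rat_of_int (circ_order m) = L_CC_10 (rat_of_int k)"
      unfolding k by (rule of_int_circ)
    show "S \<subseteq> {0..<circ_order m}" "card S = 5"
      "diameter (circulant_graph (circ_order m) S) = ereal (real_of_int k)"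
      by (fact S diam)+
    show "(1 :: int) = 1" ..
    show "rat_of_int (circ_gen2 m) = gen2 (rat_of_int k)" "rat_of_int (circ_gen3 m) = gen3 (rat_of_int k)"
      "rat_of_int (circ_gen4 m) = gen4 (rat_of_int k)" "rat_of_int (circ_gen5 m) = gen5 (rat_of_int k)"
      unfolding k by (rule of_int_circ)+
    show "card ((\<lambda>g. g mod circ_order m) ` {1, circ_gen2 m, circ_gen3 m, circ_gen4 m, circ_gen5 m}) = 5"
      "diameter (circulant_graph (circ_order m)
        ((\<lambda>g. g mod circ_order m) ` {1, circ_gen2 m, circ_gen3 m, circ_gen4 m, circ_gen5 m})) =
        ereal (real_of_int k)"
      unfolding S_def[symmetric] image by (fact S diam)+
  qed
qed

end
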